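(* Let $S$ be a finite non-empty set and let $f\colon 2^S\to[0,\infty)$ be non-decreasing and submodular with $f(\emptyset)=0$ and $f(A)>0$ for all $A\neq\emptyset$. Suppose $f$ has total curvature $\kappa<1/2$. Let $h(A)=\sum_{s\in A}f(\{s\})$ for $A\subseteq S$, and let $\mathbf x^h$ and $\mathbf p^h$ be the equilibrium strategies of the Hider and the Searcher in the submodular search game with cost function $h$ described in the context. Then $\mathbf x^h$ and $\mathbf p^h$ are $\left(\frac{1}{1-\kappa}\right)$-approximations for the equilibrium strategies in the submodular search game with cost function $f$; that is, if $V_f$ is the value of the game with cost function $f$, then $\max_{\mathbf x}C_f(\mathbf p^h,\mathbf x)\le\frac{1}{1-\kappa}V_f$ and $\min_{\mathbf p}C_f(\mathbf p,\mathbf x^h)\ge(1-\kappa)V_f$.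
   Context: For a set function $u$ on $S$, the submodular search game with cost function $u$ is the finite two-person zero-sum game in which the Searcher (minimizer) chooses a permutation $\pi$ of $S$, the Hider (maximizer) chooses $j\in S$, and the payoff is $u(S_j^\pi)$, where $S_j^\pi$ is the set consisting of $j$ and all elements preceding $j$ in $\pi$. For mixed strategies $\mathbf p$ (a probability distribution over permutations) and $\mathbf x$ (a probability distribution over $S$), $C_u(\mathbf p,\mathbf x)=\sum_\pi\sum_{j\in S}\mathbf p(\pi)\mathbf x(j)u(S_j^\pi)$ is the expected payoff. The total curvature of $f$ is $\kappa=1-\min_{s\in S}\frac{f(S)-f(S\setminus\{s\})}{f(\{s\})}$. The strategies are: $\mathbf x^h(s)=f(\{s\})/h(S)$ for $s\in S$; and $\mathbf p^h$ chooses the first element $s$ with probability $\mathbf x^h(s)$ and then searches the remaining elements in a uniformly random order. (It is known that these are equilibrium strategies of the game with the modular cost function $h$.) *)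

theory Defs
  imports "HOL-Probability.Probability" "HOL-Combinatorics.Multiset_Permutations"
begin

definition submodular_on :: "'a set \<Rightarrow> ('a set \<Rightarrow> real) \<Rightarrow> bool" where
  "submodular_on S f \<longleftrightarrow> (\<forall>A B. A \<subseteq> S \<longrightarrow> B \<subseteq> S \<longrightarrow> f (A \<union> B) + f (A \<inter> B) \<le> f A + f B)"

definition total_curvature :: "'a set \<Rightarrow> ('a set \<Rightarrow> real) \<Rightarrow> real" where
  "total_curvature S f = 1 - Min ((\<lambda>s. (f S - f (S - {s})) / f {s}) ` S)"

text \<open>A permutation of \<open>S\<close> is the list of the elements of \<open>S\<close> in the order in which they are
  searched, i.e. an element of \<^term>\<open>permutations_of_set S\<close>.  The set \<open>search_prefix \<pi> j\<close>
  consists of \<open>j\<close> and the elements that precede it in \<open>\<pi>\<close>.\<close>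

definition search_prefix :: "'a list \<Rightarrow> 'a \<Rightarrow> 'a set" where
  "search_prefix \<pi> j = insert j (set (takeWhile (\<lambda>s. s \<noteq> j) \<pi>))"

definition searcher_strategies :: "'a set \<Rightarrow> 'a list pmf set" where
  "searcher_strategies S = {p. set_pmf p \<subseteq> permutations_of_set S}"

definition hider_strategies :: "'a set \<Rightarrow> 'a pmf set" where
  "hider_strategies S = {x. set_pmf x \<subseteq> S}"

definition expected_payoff ::
    "'a set \<Rightarrow> ('a set \<Rightarrow> real) \<Rightarrow> 'a list pmf \<Rightarrow> 'a pmf \<Rightarrow> real" where
  "expected_payoff S u p x =
     (\<Sum>\<pi>\<in>permutations_of_set S. \<Sum>j\<in>S. pmf p \<pi> * pmf x j * u (search_prefix \<pi> j))"

text \<open>The value is defined as the minimax value; by the minimax theorem it is also the maximin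
  value, see \<open>game_value_eq_maximin\<close> below.\<close>

definition game_value :: "'a set \<Rightarrow> ('a set \<Rightarrow> real) \<Rightarrow> real" where
  "game_value S u =
     (INF p\<in>searcher_strategies S. SUP x\<in>hider_strategies S. expected_payoff S u p x)"

definition singleton_sum :: "('a set \<Rightarrow> real) \<Rightarrow> 'a set \<Rightarrow> real" where
  "singleton_sum f A = (\<Sum>s\<in>A. f {s})"

text \<open>The argument \<open>f\<close> of the following two strategies is the original cost function; the
  modular function \<open>h\<close> is \<^term>\<open>singleton_sum f\<close>.  The side conditions of \<^const>\<open>embed_pmf\<close> are
  discharged in \<open>pmf_modular_hider\<close>.\<close>

definition modular_hider :: "'a set \<Rightarrow> ('a set \<Rightarrow> real) \<Rightarrow> 'a pmf" where
  "modular_hider S f = embed_pmf (\<lambda>s. if s \<in> S then f {s} / singleton_sum f S else 0)"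

definition modular_searcher :: "'a set \<Rightarrow> ('a set \<Rightarrow> real) \<Rightarrow> 'a list pmf" where
  "modular_searcher S f =
     bind_pmf (modular_hider S f)
       (\<lambda>s. map_pmf (\<lambda>\<pi>. s # \<pi>) (pmf_of_set (permutations_of_set (S - {s}))))"


lemma pmf_embed_finite:
  fixes w :: "'b \<Rightarrow> real"
  assumes "finite A" "\<And>a. a \<in> A \<Longrightarrow> 0 \<le> w a" "0 < sum w A"
  defines "g \<equiv> \<lambda>a. if a \<in> A then w a / sum w A else 0"
  shows "pmf (embed_pmf g) a = g a"
proof (rule pmf_embed_pmf)
  show nn: "0 \<le> g x" for x using assms by (auto simp: g_def)
  have "(\<integral>\<^sup>+x. ennreal (g x) \<partial>count_space UNIV) = (\<Sum>x\<in>A. ennreal (g x))"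
    by (rule nn_integral_count_space'[OF assms(1)]) (auto simp: g_def)
  also have "\<dots> = ennreal (sum g A)" by (simp add: nn sum_ennreal)
  also have "sum g A = 1"
    using assms(3) by (simp add: g_def flip: sum_divide_distrib)
  finally show "(\<integral>\<^sup>+x. ennreal (g x) \<partial>count_space UNIV) = 1" by simp
qed

lemma pmf_proportional:
  fixes w :: "'b \<Rightarrow> real"
  assumes "finite A" "\<And>a. a \<in> A \<Longrightarrow> 0 \<le> w a" "0 < sum w A"
  obtains p where "set_pmf p \<subseteq> A" "\<And>a. a \<in> A \<Longrightarrow> pmf p a = w a / sum w A"
proof
  let ?p = "embed_pmf (\<lambda>a. if a \<in> A then w a / sum w A else 0)"
  note * = pmf_embed_finite[of A w, OF assms]
  show "set_pmf ?p \<subseteq> A" by (auto simp: set_pmf_iff * split: if_splits)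
  show "pmf ?p a = w a / sum w A" if "a \<in> A" for a using that by (simp add: *)
qed

lemma pmf_modular_hider:
  assumes "finite S" "S \<noteq> {}" "\<And>s. s \<in> S \<Longrightarrow> 0 < f {s}"
  shows "pmf (modular_hider S f) s = (if s \<in> S then f {s} / singleton_sum f S else 0)"
  unfolding modular_hider_def singleton_sum_def
  using assms by (intro pmf_embed_finite) (auto simp: less_imp_le intro: sum_pos)

lemma modular_hider_strategy:
  assumes "finite S" "S \<noteq> {}" "\<And>s. s \<in> S \<Longrightarrow> 0 < f {s}"
  shows "modular_hider S f \<in> hider_strategies S"
  using pmf_modular_hider[of S f] assms
  by (auto simp: hider_strategies_def set_pmf_iff split: if_splits)

lemma modular_searcher_strategy:
  assumes "finite S" "S \<noteq> {}" "\<And>s. s \<in> S \<Longrightarrow> 0 < f {s}"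
  shows "modular_searcher S f \<in> searcher_strategies S"
proof -
  have sub: "set_pmf (modular_hider S f) \<subseteq> S"
    using modular_hider_strategy[of S f] assms by (simp add: hider_strategies_def)
  have fin: "finite (permutations_of_set (S - {s}))" "permutations_of_set (S - {s}) \<noteq> {}" for s
    using assms(1) by auto
  have "s # \<pi> \<in> permutations_of_set S" if "s \<in> S" "\<pi> \<in> permutations_of_set (S - {s})" for s \<pi>
    using that by (auto simp: permutations_of_set_def)
  with sub fin show ?thesis
    by (auto simp: searcher_strategies_def modular_searcher_def set_pmf_of_set)
qed

lemma minimax_step:
  fixes c :: "'b \<Rightarrow> 'a \<Rightarrow> real"
  assumes "finite J" "finite P" "P \<noteq> {}"
    and br: "\<And>x. set_pmf x \<subseteq> J \<Longrightarrow> \<exists>\<pi>\<in>P. (\<Sum>j\<in>J. pmf x j * c \<pi> j) \<le> v"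
    and K: "\<And>\<pi> j. \<pi> \<in> P \<Longrightarrow> j \<in> J \<Longrightarrow> \<bar>c \<pi> j - v\<bar> \<le> K"
  shows "\<exists>w. (\<forall>\<pi>\<in>P. 0 \<le> w \<pi>) \<and> sum w P = real n \<and>
    (\<Sum>j\<in>J. (max 0 (\<Sum>\<pi>\<in>P. w \<pi> * (c \<pi> j - v)))\<^sup>2) \<le> real n * (real (card J) * K\<^sup>2)"
proof (induction n)
  case 0
  show ?case by (rule exI[of _ "\<lambda>_. 0"]) simp
next
  case (Suc n)
  then obtain w where w: "\<forall>\<pi>\<in>P. 0 \<le> w \<pi>" "sum w P = real n"
    and bnd: "(\<Sum>j\<in>J. (max 0 (\<Sum>\<pi>\<in>P. w \<pi> * (c \<pi> j - v)))\<^sup>2) \<le> real n * (real (card J) * K\<^sup>2)"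
    by blast
  define a where "a j = (\<Sum>\<pi>\<in>P. w \<pi> * (c \<pi> j - v))" for j
  define d where "d j = max 0 (a j)" for j
  have d0: "0 \<le> d j" for j by (simp add: d_def)
  have "\<exists>\<pi>\<in>P. (\<Sum>j\<in>J. d j * (c \<pi> j - v)) \<le> 0"
  proof (cases "sum d J = 0")
    case True
    then have "\<forall>j\<in>J. d j = 0" using d0 assms(1) by (simp add: sum_nonneg_eq_0_iff)
    then show ?thesis using assms(3) by auto
  next
    case False
    then have pos: "0 < sum d J" using d0 by (simp add: less_le sum_nonneg)
    obtain x where x: "set_pmf x \<subseteq> J" "\<And>j. j \<in> J \<Longrightarrow> pmf x j = d j / sum d J"
      using pmf_proportional[of J d] assms(1) d0 pos by blast
    obtain \<pi> where \<pi>: "\<pi> \<in> P" "(\<Sum>j\<in>J. pmf x j * c \<pi> j) \<le> v" using br[OF x(1)] by blast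
    have "(\<Sum>j\<in>J. pmf x j * c \<pi> j) = (\<Sum>j\<in>J. d j * c \<pi> j) / sum d J"
      by (simp add: x(2) sum_divide_distrib)
    with \<pi>(2) pos have "(\<Sum>j\<in>J. d j * c \<pi> j) \<le> v * sum d J" by (simp add: field_simps)
    then have "(\<Sum>j\<in>J. d j * (c \<pi> j - v)) \<le> 0"
      by (simp add: right_diff_distrib sum_subtractf sum_distrib_left mult.commute)
    with \<pi>(1) show ?thesis by blast
  qed
  then obtain \<rho> where \<rho>: "\<rho> \<in> P" "(\<Sum>j\<in>J. d j * (c \<rho> j - v)) \<le> 0" by blast
  define w' where "w' \<pi> = w \<pi> + (if \<pi> = \<rho> then 1 else 0)" for \<pi>
  have "sum w' P = real (Suc n)"
    using w(2) \<rho>(1) assms(2) by (simp add: w'_def sum.distrib)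
  moreover have "\<forall>\<pi>\<in>P. 0 \<le> w' \<pi>" using w(1) by (simp add: w'_def)
  moreover have "(\<Sum>j\<in>J. (max 0 (\<Sum>\<pi>\<in>P. w' \<pi> * (c \<pi> j - v)))\<^sup>2)
      \<le> real (Suc n) * (real (card J) * K\<^sup>2)"
  proof -
    have upd: "(\<Sum>\<pi>\<in>P. w' \<pi> * (c \<pi> j - v)) = a j + (c \<rho> j - v)" for j
    proof -
      have "(\<Sum>\<pi>\<in>P. w' \<pi> * (c \<pi> j - v))
          = a j + (\<Sum>\<pi>\<in>P. if \<pi> = \<rho> then c \<pi> j - v else 0)"
        unfolding a_def w'_def sum.distrib[symmetric]
        by (intro sum.cong) (auto simp: algebra_simps)
      then show ?thesis using \<rho>(1) assms(2) by simp
    qed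
    have "(max 0 (a j + (c \<rho> j - v)))\<^sup>2 \<le> (d j)\<^sup>2 + 2 * (d j * (c \<rho> j - v)) + K\<^sup>2"
      if j: "j \<in> J" for j
    proof -
      have "\<bar>max 0 (a j + (c \<rho> j - v))\<bar> \<le> \<bar>d j + (c \<rho> j - v)\<bar>" by (auto simp: d_def)
      then have "(max 0 (a j + (c \<rho> j - v)))\<^sup>2 \<le> (d j + (c \<rho> j - v))\<^sup>2"
        by (simp only: abs_le_square_iff)
      also have "\<dots> = (d j)\<^sup>2 + 2 * (d j * (c \<rho> j - v)) + (c \<rho> j - v)\<^sup>2"
        by (simp add: power2_eq_square algebra_simps)
      also have "(c \<rho> j - v)\<^sup>2 \<le> K\<^sup>2"
        using K[OF \<rho>(1) j] by (intro iffD1[OF abs_le_square_iff]) auto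
      finally show ?thesis by simp
    qed
    then have "(\<Sum>j\<in>J. (max 0 (\<Sum>\<pi>\<in>P. w' \<pi> * (c \<pi> j - v)))\<^sup>2)
        \<le> (\<Sum>j\<in>J. (d j)\<^sup>2 + 2 * (d j * (c \<rho> j - v)) + K\<^sup>2)"
      unfolding upd by (rule sum_mono)
    also have "\<dots> = (\<Sum>j\<in>J. (d j)\<^sup>2) + 2 * (\<Sum>j\<in>J. d j * (c \<rho> j - v)) + real (card J) * K\<^sup>2"
      by (simp add: sum.distrib sum_distrib_left)
    also have "\<dots> \<le> real n * (real (card J) * K\<^sup>2) + 0 + real (card J) * K\<^sup>2"
      using bnd \<rho>(2) unfolding d_def a_def by linarith
    finally show ?thesis by (simp add: algebra_simps)
  qed
  ultimately show ?case by blast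
qed

lemma minimax_approx:
  fixes c :: "'b \<Rightarrow> 'a \<Rightarrow> real"
  assumes "finite J" "finite P" "P \<noteq> {}" "0 < \<epsilon>"
    and br: "\<And>x. set_pmf x \<subseteq> J \<Longrightarrow> \<exists>\<pi>\<in>P. (\<Sum>j\<in>J. pmf x j * c \<pi> j) \<le> v"
  shows "\<exists>p. set_pmf p \<subseteq> P \<and> (\<forall>j\<in>J. (\<Sum>\<pi>\<in>P. pmf p \<pi> * c \<pi> j) \<le> v + \<epsilon>)"
proof -
  define K where "K = (\<Sum>\<pi>\<in>P. \<Sum>j\<in>J. \<bar>c \<pi> j - v\<bar>)"
  have K: "\<bar>c \<pi> j - v\<bar> \<le> K" if "\<pi> \<in> P" "j \<in> J" for \<pi> j
  proof -
    have "\<bar>c \<pi> j - v\<bar> \<le> (\<Sum>j\<in>J. \<bar>c \<pi> j - v\<bar>)"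
      using that assms(1) by (intro member_le_sum) auto
    also have "\<dots> \<le> K"
      unfolding K_def using that assms(2)
      by (intro member_le_sum[of \<pi> P "\<lambda>\<pi>. \<Sum>j\<in>J. \<bar>c \<pi> j - v\<bar>"]) (auto intro: sum_nonneg)
    finally show ?thesis .
  qed
  define M where "M = real (card J) * K\<^sup>2"
  obtain n0 :: nat where n0: "M / \<epsilon>\<^sup>2 \<le> real n0" using real_arch_simple by blast
  define n where "n = Suc n0"
  have n: "0 < n" "M \<le> real n * \<epsilon>\<^sup>2"
  proof -
    have "M \<le> real n0 * \<epsilon>\<^sup>2" using n0 assms(4) by (simp add: field_simps)
    also have "\<dots> \<le> real n * \<epsilon>\<^sup>2" by (intro mult_right_mono) (auto simp: n_def)
    finally show "M \<le> real n * \<epsilon>\<^sup>2" .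
  qed (simp add: n_def)
  obtain w where w: "\<forall>\<pi>\<in>P. 0 \<le> w \<pi>" "sum w P = real n"
    and bnd: "(\<Sum>j\<in>J. (max 0 (\<Sum>\<pi>\<in>P. w \<pi> * (c \<pi> j - v)))\<^sup>2) \<le> real n * M"
    unfolding M_def using minimax_step[OF assms(1-3) br K, of n] by blast
  obtain p where p: "set_pmf p \<subseteq> P" "\<And>\<pi>. \<pi> \<in> P \<Longrightarrow> pmf p \<pi> = w \<pi> / real n"
    using pmf_proportional[of P w] assms(2) w n by auto
  have "(\<Sum>\<pi>\<in>P. pmf p \<pi> * c \<pi> j) \<le> v + \<epsilon>" if j: "j \<in> J" for j
  proof -
    define a where "a = (\<Sum>\<pi>\<in>P. w \<pi> * (c \<pi> j - v))"
    have "(max 0 a)\<^sup>2 \<le> (\<Sum>j\<in>J. (max 0 (\<Sum>\<pi>\<in>P. w \<pi> * (c \<pi> j - v)))\<^sup>2)"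
      unfolding a_def
      by (rule member_le_sum[OF j, of "\<lambda>j. (max 0 (\<Sum>\<pi>\<in>P. w \<pi> * (c \<pi> j - v)))\<^sup>2"])
        (auto simp: assms(1))
    also have "\<dots> \<le> real n * (real n * \<epsilon>\<^sup>2)"
      using bnd n(2) by (meson mult_left_mono of_nat_0_le_iff order_trans)
    also have "\<dots> = (real n * \<epsilon>)\<^sup>2" by (simp add: power2_eq_square)
    finally have "max 0 a \<le> real n * \<epsilon>" by (rule power2_le_imp_le) (use assms(4) in simp)
    then have a: "a \<le> real n * \<epsilon>" by simp
    have "a = (\<Sum>\<pi>\<in>P. w \<pi> * c \<pi> j) - real n * v"
      by (simp add: a_def right_diff_distrib sum_subtractf flip: sum_distrib_right w(2))
    moreover have "(\<Sum>\<pi>\<in>P. pmf p \<pi> * c \<pi> j) = (\<Sum>\<pi>\<in>P. w \<pi> * c \<pi> j) / real n"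
      by (simp add: p(2) sum_divide_distrib)
    ultimately have "(\<Sum>\<pi>\<in>P. pmf p \<pi> * c \<pi> j) = (a + real n * v) / real n" by simp
    also have "\<dots> \<le> (real n * \<epsilon> + real n * v) / real n"
      using a by (intro divide_right_mono) auto
    also have "\<dots> = v + \<epsilon>" using n(1) by (simp add: add_divide_distrib)
    finally show ?thesis .
  qed
  with p(1) show ?thesis by blast
qed

lemma expected_payoff_hider:
  "expected_payoff S u p x =
     (\<Sum>j\<in>S. pmf x j * (\<Sum>\<pi>\<in>permutations_of_set S. pmf p \<pi> * u (search_prefix \<pi> j)))"
  unfolding expected_payoff_def
  by (subst sum.swap) (simp add: sum_distrib_left mult_ac)

lemma expected_payoff_searcher:
  "expected_payoff S u p x =
     (\<Sum>\<pi>\<in>permutations_of_set S. pmf p \<pi> * (\<Sum>j\<in>S. pmf x j * u (search_prefix \<pi> j)))"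
  by (simp add: expected_payoff_def sum_distrib_left mult_ac)

lemma convex_sum_pmf_le:
  assumes "finite A" "set_pmf p \<subseteq> A" "\<And>a. a \<in> A \<Longrightarrow> g a \<le> (b::real)"
  shows "(\<Sum>a\<in>A. pmf p a * g a) \<le> b"
proof -
  have "(\<Sum>a\<in>A. pmf p a * g a) \<le> (\<Sum>a\<in>A. pmf p a * b)"
    by (intro sum_mono mult_left_mono assms) auto
  also have "\<dots> = b" using sum_pmf_eq_1[OF assms(1,2)] by (simp flip: sum_distrib_right)
  finally show ?thesis .
qed

lemma convex_sum_pmf_ge:
  assumes "finite A" "set_pmf p \<subseteq> A" "\<And>a. a \<in> A \<Longrightarrow> (b::real) \<le> g a"
  shows "b \<le> (\<Sum>a\<in>A. pmf p a * g a)"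
  using convex_sum_pmf_le[of A p "\<lambda>a. - g a" "- b"] assms by (simp add: sum_negf)

lemma expected_payoff_bounded:
  assumes "finite S"
  obtains K where "\<And>p x. p \<in> searcher_strategies S \<Longrightarrow> x \<in> hider_strategies S \<Longrightarrow>
    \<bar>expected_payoff S u p x\<bar> \<le> K"
proof
  define K where "K = (\<Sum>\<pi>\<in>permutations_of_set S. \<Sum>j\<in>S. \<bar>u (search_prefix \<pi> j)\<bar>)"
  have "\<bar>expected_payoff S u p x\<bar> \<le> K" for p x
    unfolding expected_payoff_def K_def
  proof (intro order_trans[OF sum_abs] sum_mono)
    fix \<pi> j
    have "pmf p \<pi> * pmf x j \<le> 1" by (simp add: mult_le_one pmf_le_1)
    then show "\<bar>pmf p \<pi> * pmf x j * u (search_prefix \<pi> j)\<bar> \<le> \<bar>u (search_prefix \<pi> j)\<bar>"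
      by (simp add: abs_mult mult_left_le_one_le)
  qed
  then show "\<bar>expected_payoff S u p x\<bar> \<le> K" for p x .
qed

lemma hider_strategies_nonempty:
  assumes "S \<noteq> {}"
  shows "hider_strategies S \<noteq> {}"
proof -
  obtain j where "j \<in> S" using assms by blast
  then have "return_pmf j \<in> hider_strategies S" by (simp add: hider_strategies_def)
  then show ?thesis by blast
qed

lemma searcher_strategies_nonempty:
  assumes "finite S"
  shows "searcher_strategies S \<noteq> {}"
proof -
  have "permutations_of_set S \<noteq> {}" using assms by simp
  then obtain \<pi> where "\<pi> \<in> permutations_of_set S" by blast
  then have "return_pmf \<pi> \<in> searcher_strategies S" by (simp add: searcher_strategies_def)
  then show ?thesis by blast
qed

text \<open>Against a fixed strategy of the opponent, the supremum and the infimum over mixed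
  strategies are attained at pure strategies, so they are a maximum and a minimum.\<close>

lemma SUP_hider_eq_Max:
  assumes "finite S" "S \<noteq> {}"
  shows "(SUP x\<in>hider_strategies S. expected_payoff S u p x) =
    Max ((\<lambda>j. expected_payoff S u p (return_pmf j)) ` S)"
proof (rule antisym)
  have pure: "expected_payoff S u p (return_pmf j) =
      (\<Sum>\<pi>\<in>permutations_of_set S. pmf p \<pi> * u (search_prefix \<pi> j))" if "j \<in> S" for j
    using that assms(1) unfolding expected_payoff_hider
    by (simp add: pmf_return indicator_def if_distrib if_distribR cong: if_cong)
  have le: "expected_payoff S u p x \<le> Max ((\<lambda>j. expected_payoff S u p (return_pmf j)) ` S)"
    if "x \<in> hider_strategies S" for x
    unfolding expected_payoff_hider[of S u p x]
  proof (rule convex_sum_pmf_le[OF assms(1)])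
    fix j assume j: "j \<in> S"
    show "(\<Sum>\<pi>\<in>permutations_of_set S. pmf p \<pi> * u (search_prefix \<pi> j))
        \<le> Max ((\<lambda>j. expected_payoff S u p (return_pmf j)) ` S)"
      unfolding pure[OF j, symmetric] using j assms(1) by (intro Max_ge) auto
  qed (use that in \<open>simp add: hider_strategies_def\<close>)
  then show "(SUP x\<in>hider_strategies S. expected_payoff S u p x)
      \<le> Max ((\<lambda>j. expected_payoff S u p (return_pmf j)) ` S)"
    by (intro cSUP_least hider_strategies_nonempty assms(2))
  have "bdd_above (expected_payoff S u p ` hider_strategies S)"
    using le by (intro bdd_aboveI2)
  then show "Max ((\<lambda>j. expected_payoff S u p (return_pmf j)) ` S)
      \<le> (SUP x\<in>hider_strategies S. expected_payoff S u p x)"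
    using assms by (auto simp: hider_strategies_def intro!: cSUP_upper)
qed

lemma INF_searcher_eq_Min:
  assumes "finite S"
  shows "(INF p\<in>searcher_strategies S. expected_payoff S u p x) =
    Min ((\<lambda>\<pi>. expected_payoff S u (return_pmf \<pi>) x) ` permutations_of_set S)"
proof (rule antisym)
  have pure: "expected_payoff S u (return_pmf \<pi>) x =
      (\<Sum>j\<in>S. pmf x j * u (search_prefix \<pi> j))" if "\<pi> \<in> permutations_of_set S" for \<pi>
    using that unfolding expected_payoff_searcher
    by (simp add: pmf_return indicator_def if_distrib if_distribR cong: if_cong)
  have le: "Min ((\<lambda>\<pi>. expected_payoff S u (return_pmf \<pi>) x) ` permutations_of_set S)
      \<le> expected_payoff S u p x"
    if "p \<in> searcher_strategies S" for p
    unfolding expected_payoff_searcher[of S u p x]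
  proof (rule convex_sum_pmf_ge[OF finite_permutations_of_set])
    fix \<pi> assume \<pi>: "\<pi> \<in> permutations_of_set S"
    show "Min ((\<lambda>\<pi>. expected_payoff S u (return_pmf \<pi>) x) ` permutations_of_set S)
        \<le> (\<Sum>j\<in>S. pmf x j * u (search_prefix \<pi> j))"
      unfolding pure[OF \<pi>, symmetric] using \<pi> by (intro Min_le) auto
  qed (use that in \<open>simp add: searcher_strategies_def\<close>)
  then show "Min ((\<lambda>\<pi>. expected_payoff S u (return_pmf \<pi>) x) ` permutations_of_set S)
      \<le> (INF p\<in>searcher_strategies S. expected_payoff S u p x)"
    by (intro cINF_greatest searcher_strategies_nonempty assms)
  have "bdd_below ((\<lambda>p. expected_payoff S u p x) ` searcher_strategies S)"
    using le by (intro bdd_belowI2)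
  then show "(INF p\<in>searcher_strategies S. expected_payoff S u p x)
      \<le> Min ((\<lambda>\<pi>. expected_payoff S u (return_pmf \<pi>) x) ` permutations_of_set S)"
    using assms by (auto simp: searcher_strategies_def intro!: cINF_lower)
qed

theorem game_value_eq_maximin:
  assumes S: "finite S" "S \<noteq> {}"
  shows "game_value S u =
    (SUP x\<in>hider_strategies S. INF p\<in>searcher_strategies S. expected_payoff S u p x)"
proof (rule antisym)
  let ?P = "searcher_strategies S" and ?X = "hider_strategies S" and ?C = "expected_payoff S u"
  define v where "v = (SUP x\<in>?X. INF p\<in>?P. ?C p x)"
  obtain K where K: "\<And>p x. p \<in> ?P \<Longrightarrow> x \<in> ?X \<Longrightarrow> \<bar>?C p x\<bar> \<le> K"
    using expected_payoff_bounded[OF S(1), of u] by blast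
  note neP = searcher_strategies_nonempty[OF S(1)] and neX = hider_strategies_nonempty[OF S(2)]
  have bb: "bdd_below ((\<lambda>p. ?C p x) ` ?P)" if "x \<in> ?X" for x
    using K[OF _ that] by (intro bdd_belowI2[of _ "- K"]) (fastforce simp: abs_le_iff)
  have ba: "bdd_above (?C p ` ?X)" if "p \<in> ?P" for p
    using K[OF that] by (intro bdd_aboveI2[of _ _ K]) (fastforce simp: abs_le_iff)
  obtain p0 x0 where p0: "p0 \<in> ?P" and x0: "x0 \<in> ?X" using neP neX by blast
  have baI: "bdd_above ((\<lambda>x. INF p\<in>?P. ?C p x) ` ?X)"
  proof (intro bdd_aboveI2)
    fix x assume x: "x \<in> ?X"
    show "(INF p\<in>?P. ?C p x) \<le> K"
      using cINF_lower[OF bb[OF x] p0] K[OF p0 x] by linarith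
  qed
  have bbS: "bdd_below ((\<lambda>p. SUP x\<in>?X. ?C p x) ` ?P)"
  proof (intro bdd_belowI2)
    fix p assume p: "p \<in> ?P"
    show "- K \<le> (SUP x\<in>?X. ?C p x)"
      using cSUP_upper[OF x0 ba[OF p]] K[OF p x0] by linarith
  qed
  show "(SUP x\<in>?X. INF p\<in>?P. ?C p x) \<le> game_value S u"
    unfolding game_value_def
  proof (intro cSUP_least cINF_greatest neX neP)
    fix x p assume "x \<in> ?X" "p \<in> ?P"
    then show "(INF p\<in>?P. ?C p x) \<le> (SUP x\<in>?X. ?C p x)"
      using cINF_lower[OF bb] cSUP_upper[OF _ ba] by (meson order_trans)
  qed
  have br: "\<exists>\<pi>\<in>permutations_of_set S. (\<Sum>j\<in>S. pmf x j * u (search_prefix \<pi> j)) \<le> v"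
    if "set_pmf x \<subseteq> S" for x
  proof (rule ccontr)
    assume neg: "\<not> ?thesis"
    define m where "m = Min ((\<lambda>\<pi>. ?C (return_pmf \<pi>) x) ` permutations_of_set S)"
    have "m \<in> (\<lambda>\<pi>. ?C (return_pmf \<pi>) x) ` permutations_of_set S"
      unfolding m_def using S(1) by (intro Min_in) auto
    then obtain \<pi> where \<pi>: "\<pi> \<in> permutations_of_set S" "m = ?C (return_pmf \<pi>) x" by blast
    have "?C (return_pmf \<pi>) x = (\<Sum>j\<in>S. pmf x j * u (search_prefix \<pi> j))"
      using \<pi>(1) unfolding expected_payoff_searcher
      by (simp add: pmf_return indicator_def if_distrib if_distribR cong: if_cong)
    moreover have "m \<le> v"
      unfolding m_def v_def INF_searcher_eq_Min[OF S(1), symmetric]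
      using that by (intro cSUP_upper[OF _ baI]) (simp add: hider_strategies_def)
    ultimately show False using neg \<pi> by auto
  qed
  have "game_value S u \<le> v + \<epsilon>" if \<epsilon>: "0 < \<epsilon>" for \<epsilon>
  proof -
    have ne: "permutations_of_set S \<noteq> {}" using S(1) by simp
    obtain p where p: "set_pmf p \<subseteq> permutations_of_set S"
      "\<forall>j\<in>S. (\<Sum>\<pi>\<in>permutations_of_set S. pmf p \<pi> * u (search_prefix \<pi> j)) \<le> v + \<epsilon>"
      using minimax_approx[where c = "\<lambda>\<pi> j. u (search_prefix \<pi> j)",
          OF S(1) finite_permutations_of_set ne \<epsilon> br] by blast
    have pP: "p \<in> ?P" using p(1) by (simp add: searcher_strategies_def)
    have "(SUP x\<in>?X. ?C p x) \<le> v + \<epsilon>"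
      unfolding expected_payoff_hider using p(2) S(1)
      by (intro cSUP_least[OF neX] convex_sum_pmf_le[of S]) (simp_all add: hider_strategies_def)
    then show ?thesis
      unfolding game_value_def using cINF_lower[OF bbS pP] by linarith
  qed
  then show "game_value S u \<le> (SUP x\<in>?X. INF p\<in>?P. ?C p x)"
    unfolding v_def[symmetric] by (rule field_le_epsilon)
qed

end

theory Submission
  imports Defs
begin

text \<open>Writing \<open>w s\<close> for \<open>f {s}\<close>, the strategies \<open>x\<^sup>h\<close> and \<open>p\<^sup>h\<close> are equalizing in the game with
  cost \<open>h\<close>: against every pure strategy of the opponent the payoff is
  \<open>V = ((\<Sum>s\<in>S. w s)\<^sup>2 + (\<Sum>s\<in>S. (w s)\<^sup>2)) / (2 * (\<Sum>s\<in>S. w s))\<close>.  Submodularity gives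
  \<open>(1 - \<kappa>) * h A \<le> f A \<le> h A\<close>, so in the game with cost \<open>f\<close> the strategy \<open>p\<^sup>h\<close> guarantees at most
  \<open>V\<close> and \<open>x\<^sup>h\<close> at least \<open>(1 - \<kappa>) * V\<close>.  Hence \<open>(1 - \<kappa>) * V \<le> V\<^sub>f \<le> V\<close>, and both claims follow.\<close>

lemma search_prefix_Cons:
  "search_prefix (a # xs) j = (if j = a then {a} else insert a (search_prefix xs j))"
  by (auto simp: search_prefix_def)

lemma search_prefix_subset: "j \<in> set xs \<Longrightarrow> search_prefix xs j \<subseteq> set xs"
  by (auto simp: search_prefix_def dest: set_takeWhileD)

lemma finite_search_prefix [simp]: "finite (search_prefix xs j)"
  by (simp add: search_prefix_def)

text \<open>Reversing the order exchanges the predecessors and the successors of \<open>j\<close>.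
  This is the basis for averaging over a permutation and its reversal.\<close>

lemma search_prefix_rev:
  assumes "distinct xs" "j \<in> set xs"
  shows "search_prefix xs j \<union> search_prefix (rev xs) j = set xs"
    and "search_prefix xs j \<inter> search_prefix (rev xs) j = {j}"
proof -
  obtain ys zs where xs: "xs = ys @ j # zs" using assms(2) by (meson split_list)
  have j: "j \<notin> set ys" "j \<notin> set zs" and disj: "set ys \<inter> set zs = {}" using assms(1) xs by auto
  \<comment> \<open>Stated for arbitrary lists so that it applies both to \<open>xs\<close> and to
    its reversal \<open>rev zs @ j # rev ys\<close>.\<close>
  have "takeWhile (\<lambda>s. s \<noteq> j) (us @ j # vs) = us" if "j \<notin> set us" for us vs
    using that by (induction us) auto
  then have "search_prefix xs j = insert j (set ys)" "search_prefix (rev xs) j = insert j (set zs)"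
    using j by (simp_all add: search_prefix_def xs)
  with xs disj show "search_prefix xs j \<union> search_prefix (rev xs) j = set xs"
    and "search_prefix xs j \<inter> search_prefix (rev xs) j = {j}"
    by auto
qed

text \<open>In any order, exactly one of two distinct elements precedes the other, so the product of
  their weights occurs once, as does each square. The sum is thus independent of the order, which
  makes the Hider's strategy equalizing.\<close>

lemma sum_weighted_prefix:
  fixes w :: "'a \<Rightarrow> real"
  assumes "distinct xs"
  shows "2 * (\<Sum>j\<in>set xs. w j * sum w (search_prefix xs j))
    = (sum w (set xs))\<^sup>2 + (\<Sum>j\<in>set xs. (w j)\<^sup>2)"
  using assms
proof (induction xs)
  case Nil
  then show ?case by simp
next
  case (Cons a xs)
  have "sum w (search_prefix (a # xs) j) = w a + sum w (search_prefix xs j)" if "j \<in> set xs" for j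
  proof -
    have "a \<notin> search_prefix xs j" "j \<noteq> a" using search_prefix_subset[OF that] that Cons.prems by auto
    then show ?thesis by (simp add: search_prefix_Cons)
  qed
  then have "(\<Sum>j\<in>set xs. w j * sum w (search_prefix (a # xs) j))
      = w a * sum w (set xs) + (\<Sum>j\<in>set xs. w j * sum w (search_prefix xs j))"
    by (simp add: algebra_simps sum.distrib sum_distrib_left)
  then show ?case
    using Cons by (simp add: search_prefix_Cons power2_eq_square algebra_simps)
qed

text \<open>Pair each permutation with its reversal.\<close>

lemma sum_permutations_prefix:
  fixes w :: "'a \<Rightarrow> real"
  assumes "finite T" "j \<in> T"
  shows "2 * (\<Sum>\<pi>\<in>permutations_of_set T. sum w (search_prefix \<pi> j))
    = real (card (permutations_of_set T)) * (sum w T + w j)"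
proof -
  let ?P = "permutations_of_set T"
  have rev: "(\<Sum>\<pi>\<in>?P. sum w (search_prefix (rev \<pi>) j)) = (\<Sum>\<pi>\<in>?P. sum w (search_prefix \<pi> j))"
    by (rule sum.reindex_bij_witness[of _ rev rev]) (auto simp: permutations_of_set_def)
  \<comment> \<open>Inclusion-exclusion: the two prefixes cover \<open>T\<close> and share only
    \<open>j\<close>.\<close>
  have "sum w (search_prefix \<pi> j) + sum w (search_prefix (rev \<pi>) j) = sum w T + w j"
    if "\<pi> \<in> ?P" for \<pi>
  proof -
    have \<pi>: "distinct \<pi>" "set \<pi> = T" using that by (auto simp: permutations_of_set_def)
    show ?thesis
      using sum.union_inter[of "search_prefix \<pi> j" "search_prefix (rev \<pi>) j" w]
        search_prefix_rev[of \<pi> j] \<pi> assms(2) by simp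
  qed
  then have "(\<Sum>\<pi>\<in>?P. sum w (search_prefix \<pi> j) + sum w (search_prefix (rev \<pi>) j))
      = real (card ?P) * (sum w T + w j)"
    by simp
  then show ?thesis by (simp add: sum.distrib rev)
qed

text \<open>In a uniformly random order of \<open>T\<close>, every other element precedes
  \<open>j\<close> with probability 1/2, so the mean weight of the prefix is half of
  \<open>sum w T + w j\<close>. The leading \<open>a\<close> adds \<open>w a\<close>, unless
  \<open>j = a\<close> ends the search at once.\<close>

lemma expectation_first_then_uniform:
  fixes w :: "'a \<Rightarrow> real"
  assumes "finite T" "a \<notin> T" "j \<in> insert a T"
  shows "measure_pmf.expectation (map_pmf (\<lambda>\<pi>. a # \<pi>) (pmf_of_set (permutations_of_set T)))
      (\<lambda>\<pi>. sum w (search_prefix \<pi> j))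
    = (if j = a then w a else w a + (sum w T + w j) / 2)"
proof (cases "j = a")
  case True
  then show ?thesis by (simp add: search_prefix_Cons)
next
  case False
  let ?P = "permutations_of_set T"
  have P: "finite ?P" "?P \<noteq> {}" using assms(1) by auto
  have j: "j \<in> T" using assms(3) False by simp
  have "sum w (search_prefix (a # \<pi>) j) = w a + sum w (search_prefix \<pi> j)" if "\<pi> \<in> ?P" for \<pi>
  proof -
    have "a \<notin> search_prefix \<pi> j"
      using that search_prefix_subset[of j \<pi>] assms(2) j by (auto simp: permutations_of_set_def)
    then show ?thesis using False by (simp add: search_prefix_Cons)
  qed
  then have "(\<Sum>\<pi>\<in>?P. sum w (search_prefix (a # \<pi>) j))
      = real (card ?P) * (w a + (sum w T + w j) / 2)"
    using sum_permutations_prefix[OF assms(1) j, of w] by (simp add: sum.distrib algebra_simps)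
  moreover have "real (card ?P) \<noteq> 0" using P by (simp add: card_eq_0_iff)
  ultimately show ?thesis
    using False P by (simp add: integral_pmf_of_set)
qed

text \<open>The two lemmas that follow identify this, for the weights \<open>f {s}\<close>, as the
  value of the game with cost \<open>h\<close>.\<close>

definition modular_value :: "'a set \<Rightarrow> ('a \<Rightarrow> real) \<Rightarrow> real" where
  "modular_value S w = ((sum w S)\<^sup>2 + (\<Sum>s\<in>S. (w s)\<^sup>2)) / (2 * sum w S)"

lemma modular_hider_equalizes:
  assumes "finite S" "S \<noteq> {}" "\<And>s. s \<in> S \<Longrightarrow> 0 < f {s}" "\<pi> \<in> permutations_of_set S"
  shows "(\<Sum>j\<in>S. pmf (modular_hider S f) j * singleton_sum f (search_prefix \<pi> j))
    = modular_value S (\<lambda>s. f {s})"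
proof -
  define w where "w s = f {s}" for s
  have w: "singleton_sum f A = sum w A" for A by (simp add: singleton_sum_def w_def)
  have \<pi>: "distinct \<pi>" "set \<pi> = S" using assms(4) by (auto simp: permutations_of_set_def)
  have "(\<Sum>j\<in>S. pmf (modular_hider S f) j * singleton_sum f (search_prefix \<pi> j))
      = (\<Sum>j\<in>S. w j * sum w (search_prefix \<pi> j)) / sum w S"
    using assms by (simp add: pmf_modular_hider w sum_divide_distrib flip: w_def)
  also have "\<dots> = 2 * (\<Sum>j\<in>S. w j * sum w (search_prefix \<pi> j)) / (2 * sum w S)"
    by simp
  also have "\<dots> = modular_value S w"
    unfolding modular_value_def sum_weighted_prefix[OF \<pi>(1), of w, unfolded \<pi>(2)] ..
  finally show ?thesis unfolding w_def .
qed

text \<open>Condition on the first element \<open>s\<close>, average the resulting expectations with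
  weights proportional to \<open>w s\<close>, and observe that \<open>j\<close> cancels.\<close>

lemma modular_searcher_equalizes:
  assumes "finite S" "S \<noteq> {}" "\<And>s. s \<in> S \<Longrightarrow> 0 < f {s}" "j \<in> S"
  shows "(\<Sum>\<pi>\<in>permutations_of_set S.
      pmf (modular_searcher S f) \<pi> * singleton_sum f (search_prefix \<pi> j))
    = modular_value S (\<lambda>s. f {s})"
proof -
  define w where "w s = f {s}" for s
  define W where "W = sum w S"
  have w: "singleton_sum f A = sum w A" for A by (simp add: singleton_sum_def w_def)
  have W: "W > 0" unfolding W_def w_def using assms by (intro sum_pos) auto
  let ?E = "\<lambda>s. measure_pmf.expectation
    (map_pmf (\<lambda>\<pi>. s # \<pi>) (pmf_of_set (permutations_of_set (S - {s}))))
    (\<lambda>\<pi>. sum w (search_prefix \<pi> j))"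
  \<comment> \<open>The first summand is the formula for \<open>s \<noteq> j\<close>. For
    \<open>s = j\<close> it would give \<open>w j * (W + 2 * w j)\<close> instead of the true
    \<open>2 * (w j)\<^sup>2\<close>, hence the correction.\<close>
  have E: "2 * (w s * ?E s) = w s * (W + w s + w j) + (if s = j then - w j * W else 0)"
    if "s \<in> S" for s
  proof -
    have "sum w (S - {s}) = W - w s" using assms(1) that by (simp add: W_def sum_diff1)
    moreover have "j \<in> insert s (S - {s})" using assms(4) by simp
    ultimately have "?E s = (if j = s then w s else w s + (W - w s + w j) / 2)"
      using expectation_first_then_uniform[of "S - {s}" s j w] assms(1) by simp
    then show ?thesis by (auto simp: field_simps)
  qed
  have sub: "set_pmf (modular_hider S f) \<subseteq> S"
    using modular_hider_strategy[of S f] assms by (simp add: hider_strategies_def)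
  have sub': "set_pmf (modular_searcher S f) \<subseteq> permutations_of_set S"
    using modular_searcher_strategy[of S f] assms by (simp add: searcher_strategies_def)
  have "(\<Sum>\<pi>\<in>permutations_of_set S. pmf (modular_searcher S f) \<pi> * sum w (search_prefix \<pi> j))
      = measure_pmf.expectation (modular_searcher S f) (\<lambda>\<pi>. sum w (search_prefix \<pi> j))"
    using sub' by (subst integral_measure_pmf_real[of "permutations_of_set S"]) (auto simp: mult.commute)
  also have "\<dots> = (\<Sum>s\<in>S. pmf (modular_hider S f) s * ?E s)"
    unfolding modular_searcher_def
    by (subst pmf_expectation_bind[of S]) (use assms sub in \<open>auto simp: set_pmf_of_set\<close>)
  also have "\<dots> = (\<Sum>s\<in>S. w s * ?E s) / W"
    using assms by (simp add: pmf_modular_hider w W_def sum_divide_distrib flip: w_def)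
  finally have "(\<Sum>\<pi>\<in>permutations_of_set S.
      pmf (modular_searcher S f) \<pi> * sum w (search_prefix \<pi> j)) = (\<Sum>s\<in>S. w s * ?E s) / W" .
  \<comment> \<open>The correction at \<open>s = j\<close> removes precisely the term
    \<open>W * w j\<close> produced by the general formula.\<close>
  moreover have "2 * (\<Sum>s\<in>S. w s * ?E s) = W\<^sup>2 + (\<Sum>s\<in>S. (w s)\<^sup>2)"
  proof -
    have "2 * (\<Sum>s\<in>S. w s * ?E s)
        = (\<Sum>s\<in>S. w s * (W + w s + w j)) + (\<Sum>s\<in>S. if s = j then - w j * W else 0)"
      unfolding sum_distrib_left sum.distrib[symmetric] by (intro sum.cong refl E)
    moreover have "(\<Sum>s\<in>S. w s * (W + w s + w j)) = W * (W + w j) + (\<Sum>s\<in>S. (w s)\<^sup>2)"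
      by (simp add: W_def algebra_simps power2_eq_square sum.distrib sum_subtractf sum_distrib_left)
    ultimately show ?thesis using assms(1,4) by (simp add: algebra_simps power2_eq_square)
  qed
  ultimately show ?thesis
    using W by (simp add: modular_value_def w field_simps flip: w_def W_def)
qed

text \<open>Since \<open>f {} = 0\<close>, submodularity on disjoint sets is subadditivity; add the
  elements one at a time.\<close>

lemma submodular_le_singleton_sum:
  assumes "submodular_on S f" "f {} = 0" "finite A" "A \<subseteq> S"
  shows "f A \<le> singleton_sum f A"
  using assms(3,4)
proof (induction A)
  case empty
  then show ?case by (simp add: singleton_sum_def assms(2))
next
  case (insert a A)
  then have "f (insert a A) + f {} \<le> f {a} + f A"
    using assms(1)[unfolded submodular_on_def, rule_format, of "{a}" A] by simp
  with insert show ?case by (simp add: singleton_sum_def assms(2))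
qed

text \<open>Build \<open>A\<close> one element at a time. By diminishing returns, each increment is
  at least the last marginal \<open>f S - f (S - {a})\<close>, which the curvature bounds below by a
  multiple of \<open>f {a}\<close>.\<close>

lemma submodular_ge_curvature:
  assumes "submodular_on S f" "f {} = 0" "finite S" "\<And>s. s \<in> S \<Longrightarrow> 0 < f {s}"
    and "finite A" "A \<subseteq> S"
  shows "(1 - total_curvature S f) * singleton_sum f A \<le> f A"
  using assms(5,6)
proof (induction A)
  case empty
  then show ?case by (simp add: singleton_sum_def assms(2))
next
  case (insert a A)
  have "1 - total_curvature S f \<le> (f S - f (S - {a})) / f {a}"
    unfolding total_curvature_def using insert assms(3) by simp
  then have "(1 - total_curvature S f) * f {a} \<le> f S - f (S - {a})"
    using assms(4)[of a] insert by (simp add: pos_le_divide_eq)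
  moreover have "insert a A \<union> (S - {a}) = S" "insert a A \<inter> (S - {a}) = A"
    using insert by auto
  \<comment> \<open>Diminishing returns: \<open>a\<close> contributes at least as much to
    \<open>A\<close> as to \<open>S - {a}\<close>.\<close>
  then have "f S + f A \<le> f (insert a A) + f (S - {a})"
    using assms(1)[unfolded submodular_on_def, rule_format, of "insert a A" "S - {a}"] insert
    by auto
  ultimately show ?case using insert by (simp add: singleton_sum_def distrib_left)
qed

theorem proposition1:
  fixes S :: "'a set" and f :: "'a set \<Rightarrow> real"
  assumes "finite S" and "S \<noteq> {}"
    and "\<And>A. A \<subseteq> S \<Longrightarrow> 0 \<le> f A"
    and "mono_on (Pow S) f"
    and "submodular_on S f"
    and "f {} = 0"
    and "\<And>A. A \<subseteq> S \<Longrightarrow> A \<noteq> {} \<Longrightarrow> 0 < f A"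
    and "total_curvature S f < 1 / 2"
  shows "(SUP x\<in>hider_strategies S. expected_payoff S f (modular_searcher S f) x)
           \<le> 1 / (1 - total_curvature S f) * game_value S f \<and>
         (INF p\<in>searcher_strategies S. expected_payoff S f p (modular_hider S f))
           \<ge> (1 - total_curvature S f) * game_value S f"
proof -
  let ?P = "searcher_strategies S" and ?X = "hider_strategies S" and ?C = "expected_payoff S f"
  define c where "c = 1 - total_curvature S f"
  define V where "V = modular_value S (\<lambda>s. f {s})"
  have c: "0 < c" using assms(8) by (simp add: c_def)
  have pos: "0 < f {s}" if "s \<in> S" for s using assms(7)[of "{s}"] that by simp
  have prefix: "search_prefix \<pi> j \<subseteq> S" if "\<pi> \<in> permutations_of_set S" "j \<in> S" for \<pi> j
    using search_prefix_subset[of j \<pi>] that by (auto simp: permutations_of_set_def)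
  have ph: "modular_searcher S f \<in> ?P" by (rule modular_searcher_strategy[of S f, OF assms(1,2) pos])
  have xh: "modular_hider S f \<in> ?X" by (rule modular_hider_strategy[of S f, OF assms(1,2) pos])
  obtain K where K: "\<And>p x. p \<in> ?P \<Longrightarrow> x \<in> ?X \<Longrightarrow> \<bar>?C p x\<bar> \<le> K"
    using expected_payoff_bounded[OF assms(1), of f] by blast
  \<comment> \<open>Suprema of reals bound their members only for sets bounded above.\<close>
  have ba: "bdd_above (?C p ` ?X)" if "p \<in> ?P" for p
    using K[OF that] by (intro bdd_aboveI2[of _ _ K]) (fastforce simp: abs_le_iff)

  have upper: "?C (modular_searcher S f) x \<le> V" if x: "x \<in> ?X" for x
    unfolding expected_payoff_hider
  proof (rule convex_sum_pmf_le[OF assms(1)])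
    fix j assume j: "j \<in> S"
    have "(\<Sum>\<pi>\<in>permutations_of_set S. pmf (modular_searcher S f) \<pi> * f (search_prefix \<pi> j))
        \<le> (\<Sum>\<pi>\<in>permutations_of_set S.
            pmf (modular_searcher S f) \<pi> * singleton_sum f (search_prefix \<pi> j))"
      by (intro sum_mono mult_left_mono submodular_le_singleton_sum[OF assms(5,6)])
        (simp_all add: prefix j)
    also have "\<dots> = V"
      unfolding V_def by (rule modular_searcher_equalizes[of S f, OF assms(1,2) pos j])
    finally show "(\<Sum>\<pi>\<in>permutations_of_set S.
        pmf (modular_searcher S f) \<pi> * f (search_prefix \<pi> j)) \<le> V" .
  qed (use x in \<open>simp add: hider_strategies_def\<close>)
  have lower: "c * V \<le> ?C p (modular_hider S f)" if p: "p \<in> ?P" for p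
    unfolding expected_payoff_searcher
  proof (rule convex_sum_pmf_ge[OF finite_permutations_of_set])
    fix \<pi> assume \<pi>: "\<pi> \<in> permutations_of_set S"
    have "c * V = (\<Sum>j\<in>S. pmf (modular_hider S f) j * (c * singleton_sum f (search_prefix \<pi> j)))"
      using modular_hider_equalizes[of S f, OF assms(1,2) pos \<pi>]
      by (simp add: V_def mult.left_commute[of _ c] flip: sum_distrib_left)
    also have "\<dots> \<le> (\<Sum>j\<in>S. pmf (modular_hider S f) j * f (search_prefix \<pi> j))"
      unfolding c_def
      by (intro sum_mono mult_left_mono submodular_ge_curvature[OF assms(5,6,1) pos])
        (simp_all add: prefix \<pi>)
    finally show "c * V \<le> (\<Sum>j\<in>S. pmf (modular_hider S f) j * f (search_prefix \<pi> j))" .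
  qed (use p in \<open>simp add: searcher_strategies_def\<close>)

  have SUP_le: "(SUP x\<in>?X. ?C (modular_searcher S f) x) \<le> V"
    by (intro cSUP_least hider_strategies_nonempty assms(2) upper)
  have INF_ge: "c * V \<le> (INF p\<in>?P. ?C p (modular_hider S f))"
    by (intro cINF_greatest searcher_strategies_nonempty assms(1) lower)
  \<comment> \<open>The Hider may answer any \<open>p\<close> with \<open>modular_hider S f\<close>.
    This bounds the value from below and also supplies the lower bound that
    \<open>cINF_lower\<close> requires.\<close>
  have SUP_ge: "c * V \<le> (SUP x\<in>?X. ?C p x)" if "p \<in> ?P" for p
    using lower[OF that] cSUP_upper[OF xh ba[OF that]] by linarith
  have "c * V \<le> game_value S f"
    unfolding game_value_def
    by (intro cINF_greatest searcher_strategies_nonempty assms(1) SUP_ge)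
  then have "V \<le> 1 / c * game_value S f" using c by (simp add: field_simps)
  moreover have "game_value S f \<le> (SUP x\<in>?X. ?C (modular_searcher S f) x)"
    unfolding game_value_def using SUP_ge by (intro cINF_lower ph bdd_belowI2)
  \<comment> \<open>The value is at most \<open>V\<close>; scaling by \<open>c\<close> matches the
    Hider's guarantee \<open>INF_ge\<close>.\<close>
  then have "c * game_value S f \<le> c * V" using SUP_le c by simp
  ultimately show ?thesis using SUP_le INF_ge unfolding c_def by linarith
qed

end
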